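(* Let $AB$ and $CD$ be two segments in $\mathbb{R}^2$, each of length at most one, that cross at a point $O$ interior to both segments. Put $$a=|AO|,\quad b=|BO|,\quad c=|CO|,\quad d=|DO|,$$ and suppose that the endpoints and the two segments are labeled so that $$a\le b,\qquad c\le d,\qquad a\le c$$ (which can always be achieved by relabeling the endpoints of each segment and interchanging the two segments if necessary). Then $$|CA|+|AD|\le\sqrt2.$$
   Context: For points $u,v\in\mathbb{R}^2$, $|uv|$ denotes the Euclidean distance between $u$ and $v$. A point is interior to a segment if it lies on the segment and is not one of its endpoints. *)

theory Defs
  imports "HOL-Analysis.Analysis"
begin

end

theory Submission
  imports Defs
begin

text \<open>
  With \<open>x = |CA|\<close> and \<open>y = |AD|\<close>, Stewart's theorem for the cevian \<open>AP\<close> of the triangle \<open>ACD\<close> gives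
  \<open>d x\<^sup>2 + c y\<^sup>2 = (c + d) (a\<^sup>2 + c d)\<close>, and the Cauchy-Schwarz inequality gives
  \<open>c d (x + y)\<^sup>2 \<le> (c + d) (d x\<^sup>2 + c y\<^sup>2)\<close>. Hence
  \<open>(x + y)\<^sup>2 \<le> (c + d)\<^sup>2 (1 + a\<^sup>2 / (c d))\<close>, where \<open>c + d \<le> 1\<close> and \<open>a\<^sup>2 \<le> c d\<close>.
\<close>

lemma stewart:
  fixes A C D P :: "'a::real_inner"
  assumes "P \<in> closed_segment C D"
  shows "dist D P * (dist C A)\<^sup>2 + dist C P * (dist A D)\<^sup>2
    = dist C D * ((dist A P)\<^sup>2 + dist C P * dist D P)"
proof -
  obtain u where u: "0 \<le> u" "u \<le> 1" and P: "P = (1 - u) *\<^sub>R C + u *\<^sub>R D"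
    using assms by (auto simp: in_segment)
  \<comment> \<open>Take \<open>P\<close> as origin: \<open>A\<close>, \<open>C\<close> and
    \<open>D\<close> become \<open>q\<close>, \<open>- u *\<^sub>R e\<close> and
    \<open>(1 - u) *\<^sub>R e\<close>.\<close>
  define e where "e = D - C"
  define q where "q = A - P"
  have CP: "C - P = - (u *\<^sub>R e)" and DP: "D - P = (1 - u) *\<^sub>R e"
    by (simp_all add: P e_def algebra_simps)
  have c: "dist C P = u * norm e" and d: "dist D P = (1 - u) * norm e"
    using u by (simp_all add: dist_norm CP DP)
  have CA: "C - A = - (u *\<^sub>R e + q)" and AD: "A - D = q - (1 - u) *\<^sub>R e"
    using CP DP by (simp_all add: q_def algebra_simps)
  have x: "(dist C A)\<^sup>2 = u\<^sup>2 * (norm e)\<^sup>2 + 2 * u * (e \<bullet> q) + (norm q)\<^sup>2"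
    unfolding dist_norm CA norm_minus_cancel power2_norm_eq_inner inner_add_left inner_add_right
      inner_scaleR_left inner_scaleR_right inner_commute[of q e]
    by (simp add: power2_eq_square algebra_simps)
  have y: "(dist A D)\<^sup>2 = (1 - u)\<^sup>2 * (norm e)\<^sup>2 - 2 * (1 - u) * (e \<bullet> q) + (norm q)\<^sup>2"
    unfolding dist_norm AD power2_norm_eq_inner inner_diff_left inner_diff_right
      inner_scaleR_left inner_scaleR_right inner_commute[of q e]
    by (simp add: power2_eq_square algebra_simps)
  have s: "dist C D = norm e" "dist A P = norm q"
    by (simp_all add: e_def q_def dist_norm norm_minus_commute)
  \<comment> \<open>The weights \<open>dist D P\<close> and \<open>dist C P\<close> are in the ratio
    \<open>1 - u\<close> to \<open>u\<close>, so the terms in \<open>e \<bullet> q\<close>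
    cancel.\<close>
  show ?thesis
    unfolding c d x y s by algebra
qed

theorem lemma1:
  fixes A B C D P :: "real^2" and a b c d :: real
  assumes "dist A B \<le> 1" and "dist C D \<le> 1"
    and "closed_segment A B \<inter> closed_segment C D = {P}"
    and "P \<in> open_segment A B" and "P \<in> open_segment C D"
    and "a = dist A P" and "b = dist B P" and "c = dist C P" and "d = dist D P"
    and "a \<le> b" and "c \<le> d" and "a \<le> c"
  shows "dist C A + dist A D \<le> sqrt 2"
proof -
  define x y where "x = dist C A" and "y = dist A D"
  have seg: "P \<in> closed_segment C D"
    using assms(3) by blast
  have cd: "c + d = dist C D"
    using seg assms by (simp add: between_mem_segment[symmetric] between dist_commute)
  have pos: "0 < c" "0 < d"
    using assms by (auto simp: open_segment_def)
  have stewart': "d * x\<^sup>2 + c * y\<^sup>2 = (c + d) * (a\<^sup>2 + c * d)"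
    using stewart[OF seg, of A] assms cd by (simp add: x_def y_def)
  have "a\<^sup>2 \<le> c * d"
    using assms pos by (simp add: power2_eq_square mult_mono)
  \<comment> \<open>Cauchy-Schwarz in the form of an identity: its defect is the square dropped in
    the next step.\<close>
  have "(c * d) * (x + y)\<^sup>2 = (c + d) * (d * x\<^sup>2 + c * y\<^sup>2) - (d * x - c * y)\<^sup>2"
    by algebra
  also have "\<dots> \<le> (c + d) * (d * x\<^sup>2 + c * y\<^sup>2)"
    by simp
  also have "\<dots> = (c + d)\<^sup>2 * (a\<^sup>2 + c * d)"
    unfolding stewart' by (simp add: power2_eq_square)
  \<comment> \<open>The constant 2 arises here: \<open>c + d \<le> 1\<close> bounds the first
    factor, and \<open>a\<^sup>2 \<le> c * d\<close> doubles \<open>c * d\<close> in the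
    second.\<close>
  also have "\<dots> \<le> 1 * (2 * (c * d))"
    using \<open>a\<^sup>2 \<le> c * d\<close> pos cd assms(2) by (intro mult_mono) (auto simp: power_le_one)
  finally have "(c * d) * (x + y)\<^sup>2 \<le> (c * d) * 2"
    by simp
  then have "(x + y)\<^sup>2 \<le> 2"
    using pos by simp
  then show ?thesis
    unfolding x_def y_def by (rule real_le_rsqrt)
qed

end
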